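(* Let $\mathbb{IF}_m(\theta)$ be an $m$th order estimation influence function for $\psi(\theta)$ in the model $\mathcal M(\Theta)$. Then for any smooth, regular parametric submodel $\widetilde\theta(\zeta)$, any $\theta$ in its range, any $s\in\{1,\dots,m\}$ and any indices $l_1,\dots,l_s$, $$\frac{\partial^s E_\theta\big[\mathbb{IF}_m(\widetilde\theta(\zeta))\big]}{\partial\zeta_{l_1}\cdots\partial\zeta_{l_s}}\Big|_{\zeta=\widetilde\theta^{-1}\{\theta\}}=-\psi_{\backslash l_1,\dots,l_s}(\theta).$$ Thus, if the functionals $\theta^*\mapsto E_\theta[\mathbb{IF}_m(\theta^* )]$ and $\theta^*\mapsto-[\psi(\theta^* )-\psi(\theta)]$ have bounded Fréchet derivatives with respect to $\theta^*$ to order $m+1$ for a norm $\|\cdot\|$, then $$E_\theta[\mathbb{IF}_m(\theta+\delta\theta)]=-[\psi(\theta+\delta\theta)-\psi(\theta)]+O\big(\|\delta\theta\|^{m+1}\big),$$ since the functions $E_\theta[\mathbb{IF}_m(\theta^* )]$ and $-[\psi(\theta^* )-\psi(\theta)]$ of $\theta^*$ have the same Taylor expansion around $\theta$ up to order $m$.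
   Context: $O_1,\dots,O_n$ are i.i.d. from a model $\mathcal M(\Theta)=\{F(\cdot;\theta):\theta\in\Theta\}$; $\mathbf O_n=(O_1,\dots,O_n)$ has density $f(\mathbf O_n;\theta)=\prod_i f(O_i;\theta)$ with respect to a dominating measure; $\psi:\Theta\to\mathbb R$. For a function $b$ of $m$ arguments, $\mathbb V[b]=\frac{(n-m)!}{n!}\sum_{i_1\ne\cdots\ne i_m}b(O_{i_1},\dots,O_{i_m})$ (all indices distinct) is an $m$th order U-statistic with (not necessarily symmetric) kernel $b$; a U-statistic of order $s<m$ is also regarded as one of order $m$. An $r$-dimensional parametric submodel $\widetilde\theta(\zeta)$ maps $\zeta\in\mathbb R^r$ injectively into $\Theta$. For $\theta$ in its range and $l_1,\dots,l_s\in\{1,\dots,r\}$, set $\psi_{\backslash l_1,\dots,l_s}(\theta)=\partial^s(\psi\circ\widetilde\theta)(\zeta)/\partial\zeta_{l_1}\cdots\partial\zeta_{l_s}|_{\zeta=\widetilde\theta^{-1}\{\theta\}}$, define $f_{\backslash l_1,\dots,l_s}(\mathbf O_n;\theta)$ analogously from $f(\mathbf O_n;\widetilde\theta(\zeta))$, and define the $s$th order score $\widetilde{\mathbb S}_{s,\bar l_s}(\theta)=f_{\backslash l_1,\dots,l_s}(\mathbf O_n;\theta)/f(\mathbf O_n;\theta)$. All parametric submodels are assumed sufficiently smooth and regular that expectation and differentiation operators commute as needed. An $m$th order estimation influence function for $\psi(\theta)$ is a U-statistic $\mathbb{IF}_m(\theta)$ of order $m$ with finite variance such that (i) $E_\theta[\mathbb{IF}_m(\theta)]=0$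 for all $\theta\in\Theta$, and (ii) for $s=1,\dots,m$ and every suitably smooth and regular $r$-dimensional parametric submodel, $r=1,\dots,m$, $\psi_{\backslash\bar l_s}(\theta)=E_\theta[\mathbb{IF}_m(\theta)\widetilde{\mathbb S}_{s,\bar l_s}(\theta)]$ (equivalently, one may leave the dimension $r$ of the submodel unrestricted). In $E_\theta[\mathbb{IF}_m(\theta^* )]$ the expectation is over the data under $F(\cdot;\theta)$ with $\theta^*$ fixed.
   Formalization: For the expansion, θ is interior to Θ and it is additionally assumed that for every direction h ≠ 0 some smooth, regular one-dimensional submodel equals θ + th for t near 0; without enough regular submodels the expansion can fail. *)

theory Defs
  imports "HOL-Probability.Probability" "HOL-Library.Landau_Symbols"
begin

section \<open>Partial derivatives in a variable number of coordinates\<close>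

text \<open>
  The dimension of a submodel is quantified inside the definition of an influence function, so
  it cannot be a type. A point of \<open>r\<close>-dimensional space is a function \<open>nat \<Rightarrow> real\<close> that vanishes
  from \<open>r\<close> on; the product topology on functions induces the Euclidean topology on this set.
\<close>

definition coords :: "nat \<Rightarrow> (nat \<Rightarrow> real) set" where
  "coords r = {\<zeta>. \<forall>i\<ge>r. \<zeta> i = 0}"

definition partial :: "nat \<Rightarrow> ((nat \<Rightarrow> real) \<Rightarrow> real) \<Rightarrow> (nat \<Rightarrow> real) \<Rightarrow> real" where
  "partial l g \<zeta> = deriv (\<lambda>t. g (\<zeta>(l := t))) (\<zeta> l)"

fun partials :: "nat list \<Rightarrow> ((nat \<Rightarrow> real) \<Rightarrow> real) \<Rightarrow> (nat \<Rightarrow> real) \<Rightarrow> real" where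
  "partials [] g = g"
| "partials (l # ls) g = partial l (partials ls g)"

text \<open>\<open>k\<close> times continuously differentiable. As \<^const>\<open>deriv\<close> is total, existence of every
  partial derivative is demanded separately.\<close>

definition smooth_upto :: "nat \<Rightarrow> nat \<Rightarrow> ((nat \<Rightarrow> real) \<Rightarrow> real) \<Rightarrow> bool" where
  "smooth_upto d k g \<longleftrightarrow>
    (\<forall>ls. set ls \<subseteq> {..<d} \<longrightarrow> length ls \<le> k \<longrightarrow> continuous_on (coords d) (partials ls g)) \<and>
    (\<forall>ls. set ls \<subseteq> {..<d} \<longrightarrow> length ls < k \<longrightarrow>
      (\<forall>l<d. \<forall>\<zeta>\<in>coords d. (\<lambda>t. partials ls g (\<zeta>(l := t))) differentiable (at (\<zeta> l))))"


section \<open>Model and U-statistics\<close>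

text \<open>\<open>M\<close> is the dominating measure for one observation.\<close>

definition statistical_model :: "'a measure \<Rightarrow> 'p set \<Rightarrow> ('p \<Rightarrow> 'a \<Rightarrow> real) \<Rightarrow> bool" where
  "statistical_model M \<Theta> f \<longleftrightarrow> sigma_finite_measure M \<and>
    (\<forall>\<theta>\<in>\<Theta>. f \<theta> \<in> borel_measurable M \<and> (\<forall>x\<in>space M. 0 \<le> f \<theta> x) \<and>
      prob_space (density M (\<lambda>x. ennreal (f \<theta> x))))"

definition sample_law :: "'a measure \<Rightarrow> ('p \<Rightarrow> 'a \<Rightarrow> real) \<Rightarrow> nat \<Rightarrow> 'p \<Rightarrow> (nat \<Rightarrow> 'a) measure" where
  "sample_law M f n \<theta> = (\<Pi>\<^sub>M i\<in>{..<n}. density M (\<lambda>x. ennreal (f \<theta> x)))"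

definition expect ::
    "'a measure \<Rightarrow> ('p \<Rightarrow> 'a \<Rightarrow> real) \<Rightarrow> nat \<Rightarrow> 'p \<Rightarrow> ((nat \<Rightarrow> 'a) \<Rightarrow> real) \<Rightarrow> real" where
  "expect M f n \<theta> T = integral\<^sup>L (sample_law M f n \<theta>) T"

definition joint_density :: "('p \<Rightarrow> 'a \<Rightarrow> real) \<Rightarrow> nat \<Rightarrow> 'p \<Rightarrow> (nat \<Rightarrow> 'a) \<Rightarrow> real" where
  "joint_density f n \<theta> obs = (\<Prod>i<n. f \<theta> (obs i))"

definition ustat :: "nat \<Rightarrow> nat \<Rightarrow> ('a list \<Rightarrow> real) \<Rightarrow> (nat \<Rightarrow> 'a) \<Rightarrow> real" where
  "ustat n m b obs = fact (n - m) / fact n *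
    (\<Sum>is | length is = m \<and> distinct is \<and> set is \<subseteq> {..<n}. b (map obs is))"

text \<open>A kernel may ignore some of its arguments, so U-statistics of lower order are included.\<close>

definition is_ustat :: "'a measure \<Rightarrow> nat \<Rightarrow> nat \<Rightarrow> ((nat \<Rightarrow> 'a) \<Rightarrow> real) \<Rightarrow> bool" where
  "is_ustat M n m T \<longleftrightarrow> m \<le> n \<and>
    (\<exists>b. (\<lambda>x. b (map x [0..<m])) \<in> borel_measurable (\<Pi>\<^sub>M i\<in>{..<m}. M) \<and>
      (\<forall>obs\<in>space (\<Pi>\<^sub>M i\<in>{..<n}. M). T obs = ustat n m b obs))"


section \<open>Parametric submodels and scores\<close>

text \<open>The derivatives of \<open>\<psi>\<close> and of the joint density at a point \<open>\<theta>\<close> of the range of an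
  \<open>r\<close>-dimensional submodel \<open>\<theta>s\<close>.\<close>

definition psi_deriv ::
    "nat \<Rightarrow> ((nat \<Rightarrow> real) \<Rightarrow> 'p) \<Rightarrow> ('p \<Rightarrow> real) \<Rightarrow> nat list \<Rightarrow> 'p \<Rightarrow> real" where
  "psi_deriv r \<theta>s \<psi> ls \<theta> = partials ls (\<lambda>\<zeta>. \<psi> (\<theta>s \<zeta>)) (inv_into (coords r) \<theta>s \<theta>)"

definition density_deriv :: "('p \<Rightarrow> 'a \<Rightarrow> real) \<Rightarrow> nat \<Rightarrow> nat \<Rightarrow> ((nat \<Rightarrow> real) \<Rightarrow> 'p) \<Rightarrow>
    nat list \<Rightarrow> 'p \<Rightarrow> (nat \<Rightarrow> 'a) \<Rightarrow> real" where
  "density_deriv f n r \<theta>s ls \<theta> obs =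
    partials ls (\<lambda>\<zeta>. joint_density f n (\<theta>s \<zeta>) obs) (inv_into (coords r) \<theta>s \<theta>)"

definition score :: "('p \<Rightarrow> 'a \<Rightarrow> real) \<Rightarrow> nat \<Rightarrow> nat \<Rightarrow> ((nat \<Rightarrow> real) \<Rightarrow> 'p) \<Rightarrow>
    nat list \<Rightarrow> 'p \<Rightarrow> (nat \<Rightarrow> 'a) \<Rightarrow> real" where
  "score f n r \<theta>s ls \<theta> obs = density_deriv f n r \<theta>s ls \<theta> obs / joint_density f n \<theta> obs"

text \<open>The last clause makes the scores well defined: no derivative of the density carries mass
  where the density itself vanishes (and the quotient above is \<open>0 / 0\<close>).\<close>

definition smooth_submodel :: "'a measure \<Rightarrow> 'p set \<Rightarrow> ('p \<Rightarrow> 'a \<Rightarrow> real) \<Rightarrow> nat \<Rightarrow>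
    ('p \<Rightarrow> real) \<Rightarrow> nat \<Rightarrow> nat \<Rightarrow> ((nat \<Rightarrow> real) \<Rightarrow> 'p) \<Rightarrow> bool" where
  "smooth_submodel M \<Theta> f n \<psi> m r \<theta>s \<longleftrightarrow>
    \<theta>s ` coords r \<subseteq> \<Theta> \<and> inj_on \<theta>s (coords r) \<and>
    smooth_upto r m (\<lambda>\<zeta>. \<psi> (\<theta>s \<zeta>)) \<and>
    (AE obs in (\<Pi>\<^sub>M i\<in>{..<n}. M). smooth_upto r m (\<lambda>\<zeta>. joint_density f n (\<theta>s \<zeta>) obs)) \<and>
    (\<forall>\<theta>\<in>\<theta>s ` coords r. \<forall>ls. set ls \<subseteq> {..<r} \<longrightarrow> length ls \<le> m \<longrightarrow>
      (AE obs in (\<Pi>\<^sub>M i\<in>{..<n}. M).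
        joint_density f n \<theta> obs = 0 \<longrightarrow> density_deriv f n r \<theta>s ls \<theta> obs = 0))"

text \<open>
  Expectation and differentiation commute along the submodel, as far as needed for a
  parameter-dependent statistic \<open>T\<close>: the expectation of \<open>T (\<theta>s \<zeta>')\<close> under \<open>\<theta>s \<zeta>\<close> is smooth in
  the pair \<open>(\<zeta>, \<zeta>')\<close>, here a point of \<open>2 * r\<close>-dimensional space, and its derivatives in \<open>\<zeta>\<close> are
  obtained by differentiating the density under the integral sign. Pointwise
  differentiability of \<open>T (\<theta>s \<zeta>')\<close> in \<open>\<zeta>'\<close> is not required.
\<close>

definition fst_half :: "nat \<Rightarrow> (nat \<Rightarrow> real) \<Rightarrow> nat \<Rightarrow> real" where
  "fst_half r \<xi> i = (if i < r then \<xi> i else 0)"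

definition snd_half :: "nat \<Rightarrow> (nat \<Rightarrow> real) \<Rightarrow> nat \<Rightarrow> real" where
  "snd_half r \<xi> i = (if i < r then \<xi> (r + i) else 0)"

definition expect_deriv_commute :: "'a measure \<Rightarrow> ('p \<Rightarrow> 'a \<Rightarrow> real) \<Rightarrow> nat \<Rightarrow> nat \<Rightarrow>
    ('p \<Rightarrow> (nat \<Rightarrow> 'a) \<Rightarrow> real) \<Rightarrow> nat \<Rightarrow> ((nat \<Rightarrow> real) \<Rightarrow> 'p) \<Rightarrow> bool" where
  "expect_deriv_commute M f n m T r \<theta>s \<longleftrightarrow>
    smooth_upto (2 * r) m (\<lambda>\<xi>. expect M f n (\<theta>s (fst_half r \<xi>)) (T (\<theta>s (snd_half r \<xi>)))) \<and>
    (\<forall>\<zeta>\<in>coords r. \<forall>\<zeta>'\<in>coords r. \<forall>ls. set ls \<subseteq> {..<r} \<longrightarrow> length ls \<le> m \<longrightarrow>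
      integrable (\<Pi>\<^sub>M i\<in>{..<n}. M)
        (\<lambda>obs. T (\<theta>s \<zeta>') obs * density_deriv f n r \<theta>s ls (\<theta>s \<zeta>) obs) \<and>
      partials ls (\<lambda>\<eta>. expect M f n (\<theta>s \<eta>) (T (\<theta>s \<zeta>'))) \<zeta> =
        (LINT obs|(\<Pi>\<^sub>M i\<in>{..<n}. M). T (\<theta>s \<zeta>') obs * density_deriv f n r \<theta>s ls (\<theta>s \<zeta>) obs))"

definition regular_submodel :: "'a measure \<Rightarrow> 'p set \<Rightarrow> ('p \<Rightarrow> 'a \<Rightarrow> real) \<Rightarrow> nat \<Rightarrow>
    ('p \<Rightarrow> real) \<Rightarrow> nat \<Rightarrow> ('p \<Rightarrow> (nat \<Rightarrow> 'a) \<Rightarrow> real) \<Rightarrow>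
    nat \<Rightarrow> ((nat \<Rightarrow> real) \<Rightarrow> 'p) \<Rightarrow> bool" where
  "regular_submodel M \<Theta> f n \<psi> m T r \<theta>s \<longleftrightarrow>
    smooth_submodel M \<Theta> f n \<psi> m r \<theta>s \<and> expect_deriv_commute M f n m T r \<theta>s"


section \<open>Estimation influence functions\<close>

text \<open>\<open>\<R>\<close> is the class of smooth and regular submodels, each given with its dimension. Which
  class this is depends on the application.\<close>

definition estimation_IF :: "'a measure \<Rightarrow> 'p set \<Rightarrow> ('p \<Rightarrow> 'a \<Rightarrow> real) \<Rightarrow> nat \<Rightarrow>
    ('p \<Rightarrow> real) \<Rightarrow> (nat \<times> ((nat \<Rightarrow> real) \<Rightarrow> 'p)) set \<Rightarrow> nat \<Rightarrow>
    ('p \<Rightarrow> (nat \<Rightarrow> 'a) \<Rightarrow> real) \<Rightarrow> bool" where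
  "estimation_IF M \<Theta> f n \<psi> \<R> m T \<longleftrightarrow>
    (\<forall>\<theta>\<in>\<Theta>. is_ustat M n m (T \<theta>) \<and> integrable (sample_law M f n \<theta>) (\<lambda>obs. (T \<theta> obs)\<^sup>2)) \<and>
    (\<forall>\<theta>\<in>\<Theta>. expect M f n \<theta> (T \<theta>) = 0) \<and>
    (\<forall>(r, \<theta>s)\<in>\<R>. \<forall>\<theta>\<in>\<theta>s ` coords r. \<forall>ls.
      1 \<le> length ls \<longrightarrow> length ls \<le> m \<longrightarrow> set ls \<subseteq> {..<r} \<longrightarrow>
        integrable (sample_law M f n \<theta>) (\<lambda>obs. T \<theta> obs * score f n r \<theta>s ls \<theta> obs) \<and>
        psi_deriv r \<theta>s \<psi> ls \<theta> = expect M f n \<theta> (\<lambda>obs. T \<theta> obs * score f n r \<theta>s ls \<theta> obs))"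


section \<open>Iterated Frechet derivatives\<close>

text \<open>
  \<open>D j x\<close> is the \<open>j\<close>-th Frechet derivative at \<open>x\<close>, a \<open>j\<close>-linear form on lists of \<open>j\<close> vectors;
  the first entry is the direction differentiated last. The remainder is measured in the norm
  of \<open>j\<close>-linear forms, and the derivatives of orders \<open>1, \<dots>, k\<close> are bounded on \<open>U\<close>
  in that norm.
\<close>

definition multilinear :: "nat \<Rightarrow> ('p::real_vector list \<Rightarrow> real) \<Rightarrow> bool" where
  "multilinear j A \<longleftrightarrow>
    (\<forall>us ws. length us + 1 + length ws = j \<longrightarrow> linear (\<lambda>v. A (us @ v # ws)))"

definition bounded_frechet_derivs ::
    "nat \<Rightarrow> 'p::real_normed_vector set \<Rightarrow> ('p \<Rightarrow> real) \<Rightarrow> (nat \<Rightarrow> 'p \<Rightarrow> 'p list \<Rightarrow> real) \<Rightarrow> bool" where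
  "bounded_frechet_derivs k U F D \<longleftrightarrow>
    (\<forall>x\<in>U. D 0 x [] = F x) \<and>
    (\<forall>j\<le>k. \<forall>x\<in>U. multilinear j (D j x)) \<and>
    (\<forall>j<k. \<forall>x\<in>U. \<forall>e>0. \<exists>d>0. \<forall>y\<in>U. norm (y - x) < d \<longrightarrow>
      (\<forall>vs. length vs = j \<longrightarrow>
        \<bar>D j y vs - D j x vs - D (Suc j) x ((y - x) # vs)\<bar>
          \<le> e * norm (y - x) * prod_list (map norm vs))) \<and>
    (\<forall>j\<in>{1..k}. \<exists>C. \<forall>x\<in>U. \<forall>vs. length vs = j \<longrightarrow>
      \<bar>D j x vs\<bar> \<le> C * prod_list (map norm vs))"

end

theory Submission
  imports Defs
begin

text \<open>
  Along an \<open>r\<close>-dimensional submodel put \<open>G (\<zeta>, \<zeta>') = E\<^bsub>\<zeta>\<^esub>[IF(\<zeta>')]\<close>. Here the law of the data and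
  the argument of the influence function are separate variables, and the theorem relates the
  derivatives of \<open>G\<close> in the two of them on the diagonal \<open>\<zeta> = \<zeta>'\<close>.
  
  Differentiating under the integral sign turns a derivative of \<open>G\<close> in \<open>\<zeta>\<close> into the integral of
  \<open>IF\<close> against a derivative of the density, that is, into the expectation of \<open>IF\<close> times a score.
  So the two defining properties of an influence function say that on the diagonal
  \<open>G = 0\<close> and \<open>\<partial>\<^sub>1\<^bsup>L\<^esup> G = \<partial>\<^bsup>L\<^esup> \<psi>\<close> for every nonempty list \<open>L\<close> of at most \<open>m\<close> indices.
  Both are identities along the whole diagonal, so they can be differentiated along it, and the
  chain rule gives \<open>(\<partial>\<^sub>1 + \<partial>\<^sub>2) (\<partial>\<^sub>1\<^bsup>L\<^esup> G) = \<partial> (\<partial>\<^bsup>L\<^esup> \<psi>)\<close> there. As \<open>\<partial>\<^sub>1 \<partial>\<^sub>1\<^bsup>L\<^esup> G\<close> already equals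
  the right-hand side, \<open>\<partial>\<^sub>2 \<partial>\<^sub>1\<^bsup>L\<^esup> G = 0\<close>. Further differentiation, with partial derivatives commuting
  (lemma \<open>partial_commute_list\<close>), shows that every derivative which is mixed in the two
  variables vanishes on the diagonal (\<open>mixed_partials_zero_on_diagonal\<close>). Differentiating
  \<open>G = 0\<close> once gives \<open>\<partial>\<^sub>2 G = - \<partial>\<^sub>1 G = - \<partial> \<psi>\<close>. In each later differentiation of
  \<open>\<partial>\<^sub>2\<^bsup>L\<^esup> G = - \<partial>\<^bsup>L\<^esup> \<psi>\<close> the term with \<open>\<partial>\<^sub>1\<close> is a mixed derivative and drops out, which leaves
  \<open>\<partial>\<^sub>2\<^bsup>L\<^esup> G = - \<partial>\<^bsup>L\<^esup> \<psi>\<close> at every order (\<open>second_partials_on_diagonal\<close>).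
  
  For the expansion, the \<open>k\<close>-th Frechet derivative evaluated at \<open>k\<close> copies of \<open>h\<close> is the \<open>k\<close>-th
  ordinary derivative along the line \<open>\<theta> + t h\<close> (\<open>partials_along_line\<close>). Near \<open>t = 0\<close> this line is a
  one-dimensional submodel, so the first part identifies the derivatives of both functionals up
  to order \<open>m\<close>. Their difference then has a vanishing Taylor polynomial of degree \<open>m\<close> on each
  segment from \<open>\<theta>\<close>, and the bounds on the derivatives of order \<open>m + 1\<close> make the Lagrange remainder
  uniform in the direction (\<open>taylor_coefficients_agree_imp_bigo\<close>).
\<close>


section \<open>Mixed derivatives and the chain rule on the diagonal in two real variables\<close>

text \<open>
  The mean value theorem in the first variable is applied to a difference in the second one, and
  then in the second variable to the derivative so obtained.
\<close>
lemma second_difference_mvt: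
  fixes f fx fyx :: "real \<Rightarrow> real \<Rightarrow> real"
  assumes fx: "\<And>s t. ((\<lambda>s. f s t) has_real_derivative fx s t) (at s)"
    and fyx: "\<And>s t. ((\<lambda>t. fx s t) has_real_derivative fyx s t) (at t)"
    and e: "e > 0"
  shows "\<exists>\<sigma> \<tau>. \<bar>\<sigma> - s\<bar> \<le> e \<and> \<bar>\<tau> - t\<bar> \<le> e \<and>
    f (s + e) (t + e) - f (s + e) t - f s (t + e) + f s t = e * e * fyx \<sigma> \<tau>"
proof -
  have "((\<lambda>x. f x (t + e) - f x t) has_real_derivative fx x (t + e) - fx x t) (at x)" for x
    by (intro DERIV_diff fx)
  then obtain \<sigma> where \<sigma>: "s < \<sigma>" "\<sigma> < s + e"
    "(f (s + e) (t + e) - f (s + e) t) - (f s (t + e) - f s t) = (s + e - s) * (fx \<sigma> (t + e) - fx \<sigma> t)"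
    using MVT2[of s "s + e" "\<lambda>x. f x (t + e) - f x t" "\<lambda>x. fx x (t + e) - fx x t"] e by auto
  obtain \<tau> where \<tau>: "t < \<tau>" "\<tau> < t + e" "fx \<sigma> (t + e) - fx \<sigma> t = (t + e - t) * fyx \<sigma> \<tau>"
    using MVT2[of t "t + e" "fx \<sigma>" "fyx \<sigma>"] e fyx by auto
  show ?thesis
    using \<sigma> \<tau> by (intro exI[of _ \<sigma>] exI[of _ \<tau>]) (auto simp: algebra_simps)
qed

text \<open>
  Schwarz's theorem. The second difference over a square of side \<open>e\<close> is \<open>e\<^sup>2\<close> times a value of
  either mixed derivative inside the square. If the two differed at a corner, continuity would
  keep their values apart on small squares.
\<close>
lemma mixed_second_derivatives_eq:
  fixes f fx fy fyx fxy :: "real \<Rightarrow> real \<Rightarrow> real"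
  assumes fx: "\<And>s t. ((\<lambda>s. f s t) has_real_derivative fx s t) (at s)"
    and fy: "\<And>s t. ((\<lambda>t. f s t) has_real_derivative fy s t) (at t)"
    and fyx: "\<And>s t. ((\<lambda>t. fx s t) has_real_derivative fyx s t) (at t)"
    and fxy: "\<And>s t. ((\<lambda>s. fy s t) has_real_derivative fxy s t) (at s)"
    and cont1: "continuous_on UNIV (\<lambda>(s, t). fyx s t)"
    and cont2: "continuous_on UNIV (\<lambda>(s, t). fxy s t)"
  shows "fxy s t = fyx s t"
proof (rule ccontr)
  assume neq: "fxy s t \<noteq> fyx s t"
  \<comment> \<open>Values within \<open>K\<close> of the two limits cannot coincide.\<close>
  define K where "K = \<bar>fxy s t - fyx s t\<bar> / 2"
  have K: "K > 0"
    using neq by (simp add: K_def)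
  obtain d1 where d1: "d1 > 0" "\<And>p. dist p (s, t) < d1 \<Longrightarrow> dist (fyx (fst p) (snd p)) (fyx s t) < K"
    using cont1[unfolded continuous_on_iff] K by (force simp: case_prod_beta)
  obtain d2 where d2: "d2 > 0" "\<And>p. dist p (s, t) < d2 \<Longrightarrow> dist (fxy (fst p) (snd p)) (fxy s t) < K"
    using cont2[unfolded continuous_on_iff] K by (force simp: case_prod_beta)
  define e where "e = min d1 d2 / 3"
  have e: "e > 0" "2 * e < d1" "2 * e < d2"
    using d1 d2 by (auto simp: e_def)
  have near: "dist (\<sigma>, \<tau>) (s, t) \<le> 2 * e" if "\<bar>\<sigma> - s\<bar> \<le> e" "\<bar>\<tau> - t\<bar> \<le> e" for \<sigma> \<tau>
    using sqrt_sum_squares_le_sum_abs[of "dist \<sigma> s" "dist \<tau> t"] that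
    by (simp add: dist_Pair_Pair dist_real_def)
  from second_difference_mvt[of f fx fyx e s t, OF fx fyx e(1)]
  obtain \<sigma> \<tau> where 1: "\<bar>\<sigma> - s\<bar> \<le> e" "\<bar>\<tau> - t\<bar> \<le> e"
    "f (s + e) (t + e) - f (s + e) t - f s (t + e) + f s t = e * e * fyx \<sigma> \<tau>"
    by blast
  from second_difference_mvt[of "\<lambda>y x. f x y" "\<lambda>y x. fy x y" "\<lambda>y x. fxy x y" e t s, OF fy fxy e(1)]
  obtain \<sigma>' \<tau>' where 2: "\<bar>\<sigma>' - s\<bar> \<le> e" "\<bar>\<tau>' - t\<bar> \<le> e"
    "f (s + e) (t + e) - f s (t + e) - f (s + e) t + f s t = e * e * fxy \<sigma>' \<tau>'"
    by blast
  have "e * e * fyx \<sigma> \<tau> = e * e * fxy \<sigma>' \<tau>'"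
    using 1(3) 2(3) by linarith
  then have eq: "fyx \<sigma> \<tau> = fxy \<sigma>' \<tau>'"
    using e by simp
  have "dist (fyx \<sigma> \<tau>) (fyx s t) < K"
    using d1(2)[of "(\<sigma>, \<tau>)"] near[OF 1(1,2)] e by simp
  moreover have "dist (fxy \<sigma>' \<tau>') (fxy s t) < K"
    using d2(2)[of "(\<sigma>', \<tau>')"] near[OF 2(1,2)] e by simp
  ultimately show False
    unfolding eq K_def dist_real_def by argo
qed

text \<open>
  Continuity of one of the two partial derivatives already makes \<open>h\<close> differentiable at a point of the
  diagonal, so that the chain rule applies to \<open>s \<mapsto> (s, s)\<close>.
\<close>
lemma diagonal_has_derivative:
  fixes h hs ht :: "real \<Rightarrow> real \<Rightarrow> real"
  assumes hs: "((\<lambda>s. h s u) has_real_derivative hs u u) (at u)"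
    and ht: "\<And>s t. ((\<lambda>t. h s t) has_real_derivative ht s t) (at t)"
    and cont: "continuous_on UNIV (\<lambda>(s, t). ht s t)"
  shows "((\<lambda>s. h s s) has_real_derivative hs u u + ht u u) (at u)"
proof -
  have scale: "blinfun_apply (c *\<^sub>R id_blinfun) = (*) c" for c :: real
    by (auto simp: blinfun.scaleR_left)
  have "continuous (at (u, u)) (\<lambda>p. ht (fst p) (snd p) *\<^sub>R (id_blinfun :: real \<Rightarrow>\<^sub>L real))"
    using cont by (intro continuous_intros) (auto simp: continuous_on_eq_continuous_at case_prod_beta)
  then have "((\<lambda>(s, t). h s t) has_derivative (\<lambda>(s, t). hs u u * s + (ht u u *\<^sub>R id_blinfun) t))
      (at (u, u) within UNIV \<times> UNIV)"
    using hs ht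
    by (intro has_derivative_partialsI[where f = h and fy = "\<lambda>s t. ht s t *\<^sub>R id_blinfun"])
      (auto simp: has_field_derivative_def scale case_prod_unfold)
  then have D: "((\<lambda>(s, t). h s t) has_derivative (\<lambda>(s, t). hs u u * s + ht u u * t)) (at (u, u))"
    by (simp add: blinfun.scaleR_left)
  have "((\<lambda>s. (s, s)) has_derivative (\<lambda>s. (s, s))) (at u)"
    by (intro has_derivative_Pair has_derivative_ident)
  from has_derivative_compose[OF this D]
  have "((\<lambda>s. h s s) has_derivative (\<lambda>s. hs u u * s + ht u u * s)) (at u)"
    by simp
  moreover have "(\<lambda>s. hs u u * s + ht u u * s) = (*) (hs u u + ht u u)"
    by (auto simp: distrib_right)
  ultimately show ?thesis
    by (simp add: has_field_derivative_def)
qed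

section \<open>Iterated partial derivatives\<close>

lemma coords_upd: "\<zeta> \<in> coords d \<Longrightarrow> l < d \<Longrightarrow> \<zeta>(l := t) \<in> coords d"
  by (auto simp: coords_def)

lemma partial_cong:
  assumes "\<And>\<zeta>. \<zeta> \<in> coords d \<Longrightarrow> g \<zeta> = g' \<zeta>" "l < d" "\<zeta> \<in> coords d"
  shows "partial l g \<zeta> = partial l g' \<zeta>"
  using assms by (simp add: partial_def coords_upd)

text \<open>
  The moves \<open>\<zeta>(l := t)\<close> with \<open>l < d\<close> never leave \<^term>\<open>coords d\<close>, so values outside it, where
  \<^const>\<open>smooth_upto\<close> says nothing, do not influence the derivatives.
\<close>
lemma partials_cong:
  assumes "\<And>\<zeta>. \<zeta> \<in> coords d \<Longrightarrow> g \<zeta> = g' \<zeta>" "set ls \<subseteq> {..<d}" "\<zeta> \<in> coords d"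
  shows "partials ls g \<zeta> = partials ls g' \<zeta>"
  using assms(2,3)
  by (induction ls arbitrary: \<zeta>) (auto simp: assms(1) intro: partial_cong)

lemma smooth_upto_has_derivative:
  assumes "smooth_upto d k g" "set ls \<subseteq> {..<d}" "length ls < k" "l < d" "\<zeta> \<in> coords d"
  shows "((\<lambda>t. partials ls g (\<zeta>(l := t))) has_real_derivative partials (l # ls) g (\<zeta>(l := t))) (at t)"
proof -
  have "(\<lambda>u. partials ls g ((\<zeta>(l := t))(l := u))) differentiable (at ((\<zeta>(l := t)) l))"
    using assms coords_upd[of \<zeta> d l t] unfolding smooth_upto_def by blast
  then show ?thesis
    by (simp add: partial_def DERIV_deriv_iff_real_differentiable)
qed

lemma smooth_upto_continuous_plane:
  assumes "smooth_upto d k g" "set ls \<subseteq> {..<d}" "length ls \<le> k" "a < d" "b < d" "\<zeta> \<in> coords d"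
  shows "continuous_on UNIV (\<lambda>(s, t). partials ls g (\<zeta>(a := s, b := t)))"
proof -
  have "continuous_on (coords d) (partials ls g)"
    using assms unfolding smooth_upto_def by blast
  moreover have "continuous_on UNIV (\<lambda>p. \<zeta>(a := fst p, b := snd p) :: nat \<Rightarrow> real)"
  proof (rule continuous_on_coordinatewise_then_product)
    show "continuous_on UNIV (\<lambda>p. (\<zeta>(a := fst p, b := snd p)) i)" for i
      by (cases "i = b"; cases "i = a") (auto intro!: continuous_intros)
  qed
  ultimately show ?thesis
    using assms(4-6)
    by (auto simp: case_prod_beta coords_upd intro!: continuous_on_compose2[of "coords d" "partials ls g"])
qed

lemma partial_commute:
  assumes sm: "smooth_upto d k g" and ls: "set ls \<subseteq> {..<d}" "length ls + 2 \<le> k"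
    and ab: "a < d" "b < d" and z: "\<zeta> \<in> coords d"
  shows "partials (a # b # ls) g \<zeta> = partials (b # a # ls) g \<zeta>"
proof (cases "a = b")
  case False
  then have swap: "\<zeta>(a := s, b := t) = \<zeta>(b := t, a := s)" for s t
    by (rule fun_upd_twist)
  have "partials (a # b # ls) g (\<zeta>(a := s, b := t)) = partials (b # a # ls) g (\<zeta>(a := s, b := t))" for s t
  proof (rule mixed_second_derivatives_eq[of "\<lambda>s t. partials ls g (\<zeta>(a := s, b := t))"
        "\<lambda>s t. partials (a # ls) g (\<zeta>(a := s, b := t))" "\<lambda>s t. partials (b # ls) g (\<zeta>(a := s, b := t))"
        "\<lambda>s t. partials (b # a # ls) g (\<zeta>(a := s, b := t))"
        "\<lambda>s t. partials (a # b # ls) g (\<zeta>(a := s, b := t))"])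
    show "((\<lambda>s. partials ls g (\<zeta>(a := s, b := t))) has_real_derivative
        partials (a # ls) g (\<zeta>(a := s, b := t))) (at s)" for s t
      unfolding swap using assms by (intro smooth_upto_has_derivative) (auto simp: coords_upd)
    show "((\<lambda>s. partials (b # ls) g (\<zeta>(a := s, b := t))) has_real_derivative
        partials (a # b # ls) g (\<zeta>(a := s, b := t))) (at s)" for s t
      unfolding swap using assms by (intro smooth_upto_has_derivative) (auto simp: coords_upd)
    show "((\<lambda>t. partials ls g (\<zeta>(a := s, b := t))) has_real_derivative
        partials (b # ls) g (\<zeta>(a := s, b := t))) (at t)" for s t
      using assms by (intro smooth_upto_has_derivative) (auto simp: coords_upd)
    show "((\<lambda>t. partials (a # ls) g (\<zeta>(a := s, b := t))) has_real_derivative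
        partials (b # a # ls) g (\<zeta>(a := s, b := t))) (at t)" for s t
      using assms by (intro smooth_upto_has_derivative) (auto simp: coords_upd)
    show "continuous_on UNIV (\<lambda>(s, t). partials (b # a # ls) g (\<zeta>(a := s, b := t)))"
      "continuous_on UNIV (\<lambda>(s, t). partials (a # b # ls) g (\<zeta>(a := s, b := t)))"
      using assms by (intro smooth_upto_continuous_plane[of d k]; simp)+
  qed
  from this[of "\<zeta> a" "\<zeta> b"] show ?thesis
    by simp
qed simp

text \<open>
  One differentiation moves through a whole list by adjacent transpositions.
\<close>
lemma partial_commute_list:
  assumes sm: "smooth_upto d k g" and l: "l < d"
    and "set ls \<subseteq> {..<d}" "set ls' \<subseteq> {..<d}" "length ls + length ls' < k" "\<zeta> \<in> coords d"
  shows "partials (l # ls @ ls') g \<zeta> = partials (ls @ l # ls') g \<zeta>"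
  using assms(3-)
proof (induction ls arbitrary: \<zeta>)
  case (Cons a ls)
  have "partials (l # a # ls @ ls') g \<zeta> = partials (a # l # ls @ ls') g \<zeta>"
    using Cons.prems by (intro partial_commute[OF sm]) (auto simp: l)
  also have "\<dots> = partials (a # ls @ l # ls') g \<zeta>"
    unfolding partials.simps(2)[of a] using Cons.prems by (intro partial_cong[of d] Cons.IH) auto
  finally show ?case
    by simp
qed simp

section \<open>Functions of a pair of parameters on the diagonal\<close>

text \<open>
  The point of \<open>2 * r\<close>-dimensional space with the halves \<open>\<zeta>\<close> and \<open>\<zeta>'\<close>: for arguments in
  \<^term>\<open>coords r\<close> it is inverse to \<^const>\<open>fst_half\<close> and \<^const>\<open>snd_half\<close>. Differentiation in \<open>\<zeta>'\<close> uses
  the indices shifted by \<open>r\<close>.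
\<close>
definition pair_point :: "nat \<Rightarrow> (nat \<Rightarrow> real) \<Rightarrow> (nat \<Rightarrow> real) \<Rightarrow> nat \<Rightarrow> real" where
  "pair_point r \<zeta> \<zeta>' i = (if i < r then \<zeta> i else if i < 2 * r then \<zeta>' (i - r) else 0)"

lemma pair_point_coords: "pair_point r \<zeta> \<zeta>' \<in> coords (2 * r)"
  by (simp add: coords_def pair_point_def)

lemma fst_half_pair_point: "\<zeta> \<in> coords r \<Longrightarrow> fst_half r (pair_point r \<zeta> \<zeta>') = \<zeta>"
  by (auto simp: fst_half_def pair_point_def coords_def)

lemma snd_half_pair_point: "\<zeta>' \<in> coords r \<Longrightarrow> snd_half r (pair_point r \<zeta> \<zeta>') = \<zeta>'"
  by (auto simp: snd_half_def pair_point_def coords_def)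

lemma pair_point_upd_fst: "l < r \<Longrightarrow> pair_point r (\<zeta>(l := t)) \<zeta>' = (pair_point r \<zeta> \<zeta>')(l := t)"
  by (auto simp: pair_point_def)

lemma pair_point_upd_snd: "l < r \<Longrightarrow> pair_point r \<zeta> (\<zeta>'(l := t)) = (pair_point r \<zeta> \<zeta>')(r + l := t)"
  by (rule ext) (auto simp: pair_point_def)

lemma partials_pair_point_fst:
  "set ls \<subseteq> {..<r} \<Longrightarrow> partials ls (\<lambda>\<eta>. g (pair_point r \<eta> \<zeta>')) \<zeta> = partials ls g (pair_point r \<zeta> \<zeta>')"
  by (induction ls arbitrary: \<zeta>) (auto simp: partial_def pair_point_upd_fst pair_point_def)

lemma partials_pair_point_snd:
  "set ls \<subseteq> {..<r} \<Longrightarrow>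
    partials ls (\<lambda>\<eta>. g (pair_point r \<zeta> \<eta>)) \<zeta>' = partials (map ((+) r) ls) g (pair_point r \<zeta> \<zeta>')"
  by (induction ls arbitrary: \<zeta>') (auto simp: partial_def pair_point_upd_snd pair_point_def)

text \<open>
  Moving the coordinate \<open>l\<close> on the diagonal moves the coordinates \<open>l\<close> and \<open>r + l\<close> of the pair
  together, so the chain rule contributes one derivative in each half.
\<close>
lemma diagonal_partials_has_derivative:
  assumes sm: "smooth_upto (2 * r) k G" and ls: "set ls \<subseteq> {..<2 * r}" "length ls < k" and l: "l < r"
  shows "((\<lambda>t. partials ls G (pair_point r (\<zeta>(l := t)) (\<zeta>(l := t)))) has_real_derivative
    partials (l # ls) G (pair_point r \<zeta> \<zeta>) + partials ((r + l) # ls) G (pair_point r \<zeta> \<zeta>)) (at (\<zeta> l))"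
proof -
  let ?p = "\<lambda>s t. (pair_point r \<zeta> \<zeta>)(l := s, r + l := t)"
  have swap: "?p s t = (pair_point r \<zeta> \<zeta>)(r + l := t, l := s)" for s t
    using l by (intro fun_upd_twist) auto
  have p0: "?p (\<zeta> l) (\<zeta> l) = pair_point r \<zeta> \<zeta>"
    using l by (auto simp: pair_point_def)
  have c: "pair_point r \<zeta> \<zeta> \<in> coords (2 * r)"
    by (rule pair_point_coords)
  have "((\<lambda>s. partials ls G (?p s s)) has_real_derivative
    partials (l # ls) G (?p (\<zeta> l) (\<zeta> l)) + partials ((r + l) # ls) G (?p (\<zeta> l) (\<zeta> l))) (at (\<zeta> l))"
  proof (rule diagonal_has_derivative[where h = "\<lambda>s t. partials ls G (?p s t)"
        and hs = "\<lambda>s t. partials (l # ls) G (?p s t)" and ht = "\<lambda>s t. partials ((r + l) # ls) G (?p s t)"])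
    show "((\<lambda>s. partials ls G (?p s (\<zeta> l))) has_real_derivative partials (l # ls) G (?p (\<zeta> l) (\<zeta> l))) (at (\<zeta> l))"
      unfolding swap using ls l c
      by (intro smooth_upto_has_derivative[OF sm]) (auto simp: coords_upd)
    show "((\<lambda>t. partials ls G (?p s t)) has_real_derivative partials ((r + l) # ls) G (?p s t)) (at t)" for s t
      using ls l c by (intro smooth_upto_has_derivative[OF sm]) (auto simp: coords_upd)
    show "continuous_on UNIV (\<lambda>(s, t). partials ((r + l) # ls) G (?p s t))"
      using ls l c by (intro smooth_upto_continuous_plane[OF sm]) auto
  qed
  then show ?thesis
    using l by (simp add: p0 pair_point_upd_fst pair_point_upd_snd)
qed

text \<open>
  By induction on the number of derivatives in the second half. For a single one, the hypothesis
  \<open>eq\<close> is differentiated along the diagonal: the derivative in the first half already accounts for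
  the whole of the derivative of \<open>\<phi>\<close>. For more, the induction hypothesis is differentiated, and the term
  with the new derivative in the first half vanishes by the induction hypothesis for a longer \<open>ls\<close>.
\<close>
lemma mixed_partials_zero_on_diagonal:
  assumes smG: "smooth_upto (2 * r) k G" and sm\<phi>: "smooth_upto r k \<phi>"
    and eq: "\<And>ls \<zeta>. ls \<noteq> [] \<Longrightarrow> length ls \<le> k \<Longrightarrow> set ls \<subseteq> {..<r} \<Longrightarrow> \<zeta> \<in> coords r \<Longrightarrow>
      partials ls G (pair_point r \<zeta> \<zeta>) = partials ls \<phi> \<zeta>"
    and "ls' \<noteq> []" "ls \<noteq> []" "set ls' \<subseteq> {..<r}" "set ls \<subseteq> {..<r}"
      "length ls' + length ls \<le> k" "\<zeta> \<in> coords r"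
  shows "partials (map ((+) r) ls' @ ls) G (pair_point r \<zeta> \<zeta>) = 0"
  using assms(4-)
proof (induction ls' arbitrary: ls \<zeta>)
  case (Cons l ls')
  let ?js = "map ((+) r) ls' @ ls"
  have l: "l < r" and sub: "set ?js \<subseteq> {..<2 * r}" "length ?js < k"
    using Cons.prems by auto
  note D = diagonal_partials_has_derivative[OF smG sub l, of \<zeta>]
  have upd: "\<zeta>(l := t) \<in> coords r" for t
    using Cons.prems l by (simp add: coords_upd)
  show ?case
  proof (cases "ls' = []")
    case True
    have "((\<lambda>t. partials ls \<phi> (\<zeta>(l := t))) has_real_derivative partials (l # ls) \<phi> \<zeta>) (at (\<zeta> l))"
      using smooth_upto_has_derivative[OF sm\<phi>, of ls l \<zeta> "\<zeta> l"] Cons.prems l by simp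
    also have "(\<lambda>t. partials ls \<phi> (\<zeta>(l := t)))
        = (\<lambda>t. partials ?js G (pair_point r (\<zeta>(l := t)) (\<zeta>(l := t))))"
      using True Cons.prems upd by (intro ext) (simp add: eq)
    finally have "partials (l # ls) \<phi> \<zeta>
        = partials (l # ?js) G (pair_point r \<zeta> \<zeta>) + partials ((r + l) # ?js) G (pair_point r \<zeta> \<zeta>)"
      using D by (rule DERIV_unique)
    moreover have "partials (l # ?js) G (pair_point r \<zeta> \<zeta>) = partials (l # ls) \<phi> \<zeta>"
      using eq[of "l # ls" \<zeta>] True Cons.prems by simp
    ultimately show ?thesis
      by simp
  next
    case False
    have "partials ?js G (pair_point r (\<zeta>(l := t)) (\<zeta>(l := t))) = 0" for t
      using False Cons.prems upd[of t] by (intro Cons.IH) (auto simp del: fun_upd_apply)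
    then have "partials (l # ?js) G (pair_point r \<zeta> \<zeta>) + partials ((r + l) # ?js) G (pair_point r \<zeta> \<zeta>) = 0"
      using D by (simp add: DERIV_unique[OF _ DERIV_const])
    moreover have "partials (l # ?js) G (pair_point r \<zeta> \<zeta>)
        = partials (map ((+) r) ls' @ l # ls) G (pair_point r \<zeta> \<zeta>)"
      using Cons.prems l by (intro partial_commute_list[OF smG]) (auto simp: pair_point_coords)
    moreover have "\<dots> = 0"
      using False Cons.prems l by (intro Cons.IH) auto
    ultimately show ?thesis
      by simp
  qed
qed simp

text \<open>
  The identity for \<open>ls\<close>, or \<open>zero\<close> when \<open>ls\<close> is empty, is differentiated along the diagonal. The
  derivative in the first half contributes a mixed derivative, which vanishes. Only in the first
  step is it unmixed: there it is a derivative of \<open>\<phi>\<close>, and this is where the sign comes from.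
\<close>
lemma second_partials_on_diagonal:
  assumes smG: "smooth_upto (2 * r) k G" and sm\<phi>: "smooth_upto r k \<phi>"
    and zero: "\<And>\<zeta>. \<zeta> \<in> coords r \<Longrightarrow> G (pair_point r \<zeta> \<zeta>) = 0"
    and eq: "\<And>ls \<zeta>. ls \<noteq> [] \<Longrightarrow> length ls \<le> k \<Longrightarrow> set ls \<subseteq> {..<r} \<Longrightarrow> \<zeta> \<in> coords r \<Longrightarrow>
      partials ls G (pair_point r \<zeta> \<zeta>) = partials ls \<phi> \<zeta>"
    and "ls \<noteq> []" "set ls \<subseteq> {..<r}" "length ls \<le> k" "\<zeta> \<in> coords r"
  shows "partials (map ((+) r) ls) G (pair_point r \<zeta> \<zeta>) = - partials ls \<phi> \<zeta>"
  using assms(5-)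
proof (induction ls arbitrary: \<zeta>)
  case (Cons l ls)
  let ?js = "map ((+) r) ls"
  have l: "l < r" and sub: "set ?js \<subseteq> {..<2 * r}" "length ?js < k"
    using Cons.prems by auto
  note D = diagonal_partials_has_derivative[OF smG sub l, of \<zeta>]
  have upd: "\<zeta>(l := t) \<in> coords r" for t
    using Cons.prems l by (simp add: coords_upd)
  show ?case
  proof (cases "ls = []")
    case True
    have "partials [l] G (pair_point r \<zeta> \<zeta>) + partials [r + l] G (pair_point r \<zeta> \<zeta>) = 0"
      using D zero[OF upd] True by (simp add: DERIV_unique[OF _ DERIV_const])
    then show ?thesis
      using eq[of "[l]" \<zeta>] True Cons.prems by simp
  next
    case False
    have "((\<lambda>t. - partials ls \<phi> (\<zeta>(l := t))) has_real_derivative - partials (l # ls) \<phi> \<zeta>) (at (\<zeta> l))"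
      using smooth_upto_has_derivative[OF sm\<phi>, of ls l \<zeta> "\<zeta> l"] Cons.prems l
      by (intro DERIV_minus) simp
    also have "(\<lambda>t. - partials ls \<phi> (\<zeta>(l := t)))
        = (\<lambda>t. partials ?js G (pair_point r (\<zeta>(l := t)) (\<zeta>(l := t))))"
    proof
      show "- partials ls \<phi> (\<zeta>(l := t)) = partials ?js G (pair_point r (\<zeta>(l := t)) (\<zeta>(l := t)))" for t
        using Cons.IH[OF False _ _ upd[of t]] Cons.prems by (simp del: fun_upd_apply)
    qed
    finally have "- partials (l # ls) \<phi> \<zeta>
        = partials (l # ?js) G (pair_point r \<zeta> \<zeta>) + partials ((r + l) # ?js) G (pair_point r \<zeta> \<zeta>)"
      using D by (rule DERIV_unique)
    moreover have "partials (l # ?js) G (pair_point r \<zeta> \<zeta>) = partials (?js @ [l]) G (pair_point r \<zeta> \<zeta>)"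
      using partial_commute_list[OF smG, of l ?js "[]" "pair_point r \<zeta> \<zeta>"] sub l pair_point_coords by simp
    moreover have "\<dots> = 0"
      using False Cons.prems l by (intro mixed_partials_zero_on_diagonal[OF smG sm\<phi> eq]) auto
    ultimately show ?thesis
      by simp
  qed
qed simp

section \<open>Scores and the derivatives of an influence function\<close>

lemma sample_law_eq_density:
  assumes "statistical_model M \<Theta> f" "\<theta> \<in> \<Theta>"
  shows "sample_law M f n \<theta> = density (\<Pi>\<^sub>M i\<in>{..<n}. M) (\<lambda>obs. ennreal (joint_density f n \<theta> obs))"
    and "joint_density f n \<theta> \<in> borel_measurable (\<Pi>\<^sub>M i\<in>{..<n}. M)"
    and "\<And>obs. obs \<in> space (\<Pi>\<^sub>M i\<in>{..<n}. M) \<Longrightarrow> 0 \<le> joint_density f n \<theta> obs"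
proof -
  have [measurable]: "f \<theta> \<in> borel_measurable M" and nonneg: "\<And>x. x \<in> space M \<Longrightarrow> 0 \<le> f \<theta> x"
    and prob: "prob_space (density M (\<lambda>x. ennreal (f \<theta> x)))" and sf: "sigma_finite_measure M"
    using assms by (auto simp: statistical_model_def)
  let ?D = "density M (\<lambda>x. ennreal (f \<theta> x))" and ?P = "\<Pi>\<^sub>M i\<in>{..<n}. M"
  interpret D: prob_space ?D by (rule prob)
  interpret PD: product_sigma_finite "\<lambda>_::nat. ?D" by standard
  interpret M: sigma_finite_measure M by (rule sf)
  interpret P: product_sigma_finite "\<lambda>_::nat. M" by standard
  show meas[measurable]: "joint_density f n \<theta> \<in> borel_measurable ?P"
    unfolding joint_density_def by measurable
  show "0 \<le> joint_density f n \<theta> obs" if "obs \<in> space ?P" for obs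
    using that nonneg unfolding joint_density_def
    by (intro prod_nonneg) (auto simp: space_PiM PiE_def Pi_def)
  have "density ?P (\<lambda>obs. ennreal (joint_density f n \<theta> obs)) = PiM {..<n} (\<lambda>_. ?D)"
  proof (rule PD.PiM_eqI)
    show "sets (density ?P (\<lambda>obs. ennreal (joint_density f n \<theta> obs))) = sets (PiM {..<n} (\<lambda>_. ?D))"
      by (auto intro!: sets_PiM_cong)
    fix A :: "nat \<Rightarrow> 'a set" assume "\<And>i. i \<in> {..<n} \<Longrightarrow> A i \<in> sets ?D"
    then have A[measurable]: "\<And>i. i \<in> {..<n} \<Longrightarrow> A i \<in> sets M" by simp
    have "emeasure (density ?P (\<lambda>obs. ennreal (joint_density f n \<theta> obs))) (Pi\<^sub>E {..<n} A)
        = (\<integral>\<^sup>+ obs. ennreal (joint_density f n \<theta> obs) * indicator (Pi\<^sub>E {..<n} A) obs \<partial>?P)"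
      using A by (intro emeasure_density) (auto intro!: sets_PiM_I_finite)
    also have "\<dots> = (\<integral>\<^sup>+ obs. (\<Prod>i<n. ennreal (f \<theta> (obs i)) * indicator (A i) (obs i)) \<partial>?P)"
    proof (rule nn_integral_cong)
      fix obs assume obs: "obs \<in> space ?P"
      have "ennreal (joint_density f n \<theta> obs) = (\<Prod>i<n. ennreal (f \<theta> (obs i)))"
        using obs nonneg unfolding joint_density_def
        by (subst prod_ennreal) (auto simp: space_PiM PiE_def Pi_def)
      moreover have "indicator (Pi\<^sub>E {..<n} A) obs = (\<Prod>i<n. indicator (A i) (obs i) :: ennreal)"
        using obs by (auto simp: indicator_def space_PiM PiE_def Pi_def prod_zero_iff)
      ultimately show "ennreal (joint_density f n \<theta> obs) * indicator (Pi\<^sub>E {..<n} A) obs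
          = (\<Prod>i<n. ennreal (f \<theta> (obs i)) * indicator (A i) (obs i))"
        by (simp add: prod.distrib)
    qed
    also have "\<dots> = (\<Prod>i<n. \<integral>\<^sup>+ x. ennreal (f \<theta> x) * indicator (A i) x \<partial>M)"
      using A by (intro P.product_nn_integral_prod) auto
    also have "\<dots> = (\<Prod>i<n. emeasure ?D (A i))"
      using A by (intro prod.cong) (auto simp: emeasure_density)
    finally show "emeasure (density ?P (\<lambda>obs. ennreal (joint_density f n \<theta> obs))) (Pi\<^sub>E {..<n} A)
        = (\<Prod>i<n. emeasure ?D (A i))" .
  qed simp
  then show "sample_law M f n \<theta> = density ?P (\<lambda>obs. ennreal (joint_density f n \<theta> obs))"
    by (simp add: sample_law_def)
qed

text \<open>
  The density in the law of the data cancels the denominator of the score. Where the density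
  vanishes there is nothing to cancel, and \<open>null\<close> makes both sides zero.
\<close>
lemma expect_times_score:
  assumes model: "statistical_model M \<Theta> f" and \<theta>: "\<theta> \<in> \<Theta>"
    and null: "AE obs in (\<Pi>\<^sub>M i\<in>{..<n}. M).
        joint_density f n \<theta> obs = 0 \<longrightarrow> density_deriv f n r \<theta>s ls \<theta> obs = 0"
    and int1: "integrable (sample_law M f n \<theta>) (\<lambda>obs. T obs * score f n r \<theta>s ls \<theta> obs)"
    and int2: "integrable (\<Pi>\<^sub>M i\<in>{..<n}. M) (\<lambda>obs. T obs * density_deriv f n r \<theta>s ls \<theta> obs)"
  shows "expect M f n \<theta> (\<lambda>obs. T obs * score f n r \<theta>s ls \<theta> obs)
    = (LINT obs|(\<Pi>\<^sub>M i\<in>{..<n}. M). T obs * density_deriv f n r \<theta>s ls \<theta> obs)"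
proof -
  let ?P = "\<Pi>\<^sub>M i\<in>{..<n}. M" and ?j = "joint_density f n \<theta>"
  note law = sample_law_eq_density[OF model \<theta>, where n = n]
  have meas: "(\<lambda>obs. T obs * score f n r \<theta>s ls \<theta> obs) \<in> borel_measurable ?P"
    using borel_measurable_integrable[OF int1] by (simp add: law(1))
  have "expect M f n \<theta> (\<lambda>obs. T obs * score f n r \<theta>s ls \<theta> obs)
      = (LINT obs|?P. ?j obs *\<^sub>R (T obs * score f n r \<theta>s ls \<theta> obs))"
    unfolding expect_def law(1)
    using meas law(2,3) by (intro integral_density) (auto intro: AE_I2)
  also have "\<dots> = (LINT obs|?P. T obs * density_deriv f n r \<theta>s ls \<theta> obs)"
  proof (rule integral_cong_AE)
    show "AE obs in ?P. ?j obs *\<^sub>R (T obs * score f n r \<theta>s ls \<theta> obs)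
        = T obs * density_deriv f n r \<theta>s ls \<theta> obs"
      using null by eventually_elim (auto simp: score_def)
  qed (use meas law(2) int2 in \<open>auto intro!: borel_measurable_times\<close>)
  finally show ?thesis .
qed

text \<open>
  The lemma on the diagonal is applied to the expectation of \<open>T (\<theta>s \<zeta>')\<close> under \<open>\<theta>s \<zeta>\<close>, as a function
  of the pair, and to \<open>\<psi> \<circ> \<theta>s\<close>. Its hypothesis on derivatives in the first half is the score identity
  of an influence function, read through differentiation under the integral sign.
\<close>
lemma influence_partials:
  assumes model: "statistical_model M \<Theta> f"
    and reg: "regular_submodel M \<Theta> f n \<psi> m T r \<theta>s"
    and inf: "estimation_IF M \<Theta> f n \<psi> \<R> m T"
    and R: "(r, \<theta>s) \<in> \<R>" and \<theta>: "\<theta> \<in> \<theta>s ` coords r"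
    and ls: "ls \<noteq> []" "length ls \<le> m" "set ls \<subseteq> {..<r}"
  shows "partials ls (\<lambda>\<zeta>. expect M f n \<theta> (T (\<theta>s \<zeta>))) (inv_into (coords r) \<theta>s \<theta>)
    = - psi_deriv r \<theta>s \<psi> ls \<theta>"
proof -
  let ?g = "\<lambda>\<xi>. expect M f n (\<theta>s (fst_half r \<xi>)) (T (\<theta>s (snd_half r \<xi>)))"
  let ?\<phi> = "\<lambda>\<zeta>. \<psi> (\<theta>s \<zeta>)"
  have sub: "\<theta>s ` coords r \<subseteq> \<Theta>" and inj: "inj_on \<theta>s (coords r)" and sm\<phi>: "smooth_upto r m ?\<phi>"
    and smG: "smooth_upto (2 * r) m ?g"
    and null: "\<And>\<zeta> ls. \<zeta> \<in> coords r \<Longrightarrow> set ls \<subseteq> {..<r} \<Longrightarrow> length ls \<le> m \<Longrightarrow>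
      AE obs in (\<Pi>\<^sub>M i\<in>{..<n}. M).
        joint_density f n (\<theta>s \<zeta>) obs = 0 \<longrightarrow> density_deriv f n r \<theta>s ls (\<theta>s \<zeta>) obs = 0"
    using reg by (auto simp: regular_submodel_def smooth_submodel_def expect_deriv_commute_def)
  have comm: "integrable (\<Pi>\<^sub>M i\<in>{..<n}. M) (\<lambda>obs. T (\<theta>s \<zeta>) obs * density_deriv f n r \<theta>s ls (\<theta>s \<zeta>) obs)"
    "partials ls (\<lambda>\<eta>. expect M f n (\<theta>s \<eta>) (T (\<theta>s \<zeta>))) \<zeta>
      = (LINT obs|(\<Pi>\<^sub>M i\<in>{..<n}. M). T (\<theta>s \<zeta>) obs * density_deriv f n r \<theta>s ls (\<theta>s \<zeta>) obs)"
    if "\<zeta> \<in> coords r" "set ls \<subseteq> {..<r}" "length ls \<le> m" for \<zeta> ls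
    using reg that by (auto simp: regular_submodel_def expect_deriv_commute_def)
  have IF: "integrable (sample_law M f n (\<theta>s \<zeta>)) (\<lambda>obs. T (\<theta>s \<zeta>) obs * score f n r \<theta>s ls (\<theta>s \<zeta>) obs)"
    "psi_deriv r \<theta>s \<psi> ls (\<theta>s \<zeta>)
      = expect M f n (\<theta>s \<zeta>) (\<lambda>obs. T (\<theta>s \<zeta>) obs * score f n r \<theta>s ls (\<theta>s \<zeta>) obs)"
    if "\<zeta> \<in> coords r" "ls \<noteq> []" "set ls \<subseteq> {..<r}" "length ls \<le> m" for \<zeta> ls
  proof -
    have "1 \<le> length ls" using that(2) by (cases ls) auto
    with that show "integrable (sample_law M f n (\<theta>s \<zeta>)) (\<lambda>obs. T (\<theta>s \<zeta>) obs * score f n r \<theta>s ls (\<theta>s \<zeta>) obs)"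
      "psi_deriv r \<theta>s \<psi> ls (\<theta>s \<zeta>)
        = expect M f n (\<theta>s \<zeta>) (\<lambda>obs. T (\<theta>s \<zeta>) obs * score f n r \<theta>s ls (\<theta>s \<zeta>) obs)"
      using inf R unfolding estimation_IF_def by blast+
  qed
  have psi: "psi_deriv r \<theta>s \<psi> ls (\<theta>s \<zeta>) = partials ls ?\<phi> \<zeta>" if "\<zeta> \<in> coords r" for \<zeta> ls
    using that inj by (simp add: psi_deriv_def)
  have eq: "partials ls ?g (pair_point r \<zeta> \<zeta>) = partials ls ?\<phi> \<zeta>"
    if z: "\<zeta> \<in> coords r" and l: "ls \<noteq> []" "length ls \<le> m" "set ls \<subseteq> {..<r}" for \<zeta> ls
  proof -
    have "partials ls ?g (pair_point r \<zeta> \<zeta>) = partials ls (\<lambda>\<eta>. ?g (pair_point r \<eta> \<zeta>)) \<zeta>"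
      using l by (simp add: partials_pair_point_fst[where g = ?g])
    also have "\<dots> = partials ls (\<lambda>\<eta>. expect M f n (\<theta>s \<eta>) (T (\<theta>s \<zeta>))) \<zeta>"
      using l z by (intro partials_cong[of r]) (auto simp: fst_half_pair_point snd_half_pair_point)
    also have "\<dots> = expect M f n (\<theta>s \<zeta>) (\<lambda>obs. T (\<theta>s \<zeta>) obs * score f n r \<theta>s ls (\<theta>s \<zeta>) obs)"
      unfolding comm(2)[OF z l(3,2)] using z l sub
      by (intro expect_times_score[OF model, symmetric] null IF comm) auto
    also have "\<dots> = partials ls ?\<phi> \<zeta>"
      using IF(2)[OF z l(1,3,2)] psi[OF z] by simp
    finally show ?thesis .
  qed
  obtain \<zeta> where z: "\<zeta> \<in> coords r" "\<theta> = \<theta>s \<zeta>"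
    using \<theta> by auto
  have "partials ls (\<lambda>\<eta>. expect M f n \<theta> (T (\<theta>s \<eta>))) \<zeta> = partials ls (\<lambda>\<eta>. ?g (pair_point r \<zeta> \<eta>)) \<zeta>"
    using ls z by (intro partials_cong[of r]) (auto simp: fst_half_pair_point snd_half_pair_point)
  also have "\<dots> = partials (map ((+) r) ls) ?g (pair_point r \<zeta> \<zeta>)"
    using ls by (simp add: partials_pair_point_snd[where g = ?g])
  also have "\<dots> = - partials ls ?\<phi> \<zeta>"
  proof (rule second_partials_on_diagonal[OF smG sm\<phi> _ eq])
    show "?g (pair_point r \<zeta> \<zeta>) = 0" if "\<zeta> \<in> coords r" for \<zeta>
      using that inf sub by (auto simp: fst_half_pair_point snd_half_pair_point estimation_IF_def)
  qed (use ls z in auto)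
  finally show ?thesis
    using z inj psi by simp
qed

section \<open>Frechet derivatives along a line and the Taylor expansion\<close>

lemma bounded_frechet_derivsD:
  assumes "bounded_frechet_derivs k U F D" "x \<in> U"
  shows "D 0 x [] = F x"
    and "j \<le> k \<Longrightarrow> multilinear j (D j x)"
    and "j < k \<Longrightarrow> e > 0 \<Longrightarrow> \<exists>d>0. \<forall>y\<in>U. norm (y - x) < d \<longrightarrow> (\<forall>vs. length vs = j \<longrightarrow>
      \<bar>D j y vs - D j x vs - D (Suc j) x ((y - x) # vs)\<bar> \<le> e * norm (y - x) * prod_list (map norm vs))"
    and "1 \<le> j \<Longrightarrow> j \<le> k \<Longrightarrow>
      \<exists>C. \<forall>x\<in>U. \<forall>vs. length vs = j \<longrightarrow> \<bar>D j x vs\<bar> \<le> C * prod_list (map norm vs)"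
  using assms by (simp_all add: bounded_frechet_derivs_def)

lemma multilinear_first: "multilinear (Suc j) A \<Longrightarrow> length vs = j \<Longrightarrow> linear (\<lambda>v. A (v # vs))"
  unfolding multilinear_def by (drule spec[of _ "[]"], drule spec[of _ vs]) simp

text \<open>
  The direction of the last differentiation enters \<open>D (Suc j)\<close> as its first argument, which is a
  multiple of \<open>h\<close> on the line and comes out by linearity.
\<close>
lemma frechet_derivs_along_line:
  fixes x h :: "'p::real_normed_vector"
  assumes D: "bounded_frechet_derivs k U F D" and U: "open U" and x: "x + t *\<^sub>R h \<in> U" and j: "j < k"
  shows "((\<lambda>s. D j (x + s *\<^sub>R h) (replicate j h)) has_real_derivative
    D (Suc j) (x + t *\<^sub>R h) (replicate (Suc j) h)) (at t)"
proof -
  let ?y = "\<lambda>s. x + s *\<^sub>R h" and ?vs = "replicate j h"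
  have "linear (\<lambda>v. D (Suc j) (?y t) (v # ?vs))"
    using bounded_frechet_derivsD(2)[OF D x, of "Suc j"] j by (intro multilinear_first) auto
  from linear_scale[OF this, of _ h]
  have lin: "D (Suc j) (?y t) (c *\<^sub>R h # ?vs) = c * D (Suc j) (?y t) (replicate (Suc j) h)" for c
    by simp
  have "\<exists>d>0. \<forall>s. norm (s - t) < d \<longrightarrow> norm (D j (?y s) ?vs - D j (?y t) ?vs
      - D (Suc j) (?y t) (replicate (Suc j) h) * (s - t)) \<le> e * norm (s - t)" if e: "e > 0" for e
  proof -
    \<comment> \<open>The remainder bound carries \<open>norm h\<close> once for each of the \<open>j\<close> fixed arguments and once for
      the step; the summand \<open>1\<close> covers \<open>h = 0\<close>.\<close>
    define e' where "e' = e / (1 + norm h ^ Suc j)"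
    have pos: "1 + norm h ^ Suc j > 0"
      by (intro add_pos_nonneg) auto
    have e': "e' > 0" "e' * norm h ^ Suc j \<le> e"
      using e pos by (auto simp: e'_def field_simps)
    obtain d where d: "d > 0" "\<And>y vs. y \<in> U \<Longrightarrow> norm (y - ?y t) < d \<Longrightarrow> length vs = j \<Longrightarrow>
        \<bar>D j y vs - D j (?y t) vs - D (Suc j) (?y t) ((y - ?y t) # vs)\<bar>
          \<le> e' * norm (y - ?y t) * prod_list (map norm vs)"
      using bounded_frechet_derivsD(3)[OF D x j e'(1)] by blast
    have "(?y \<longlongrightarrow> ?y t) (nhds t)"
      by (intro tendsto_intros filterlim_ident)
    then have ev: "eventually (\<lambda>s. ?y s \<in> U \<and> dist (?y s) (?y t) < d) (nhds t)"
      using topological_tendstoD[OF _ U x] tendstoD[OF _ d(1)] by (intro eventually_conj) blast+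
    then obtain \<epsilon> where \<epsilon>: "\<epsilon> > 0" "\<And>s. dist s t < \<epsilon> \<Longrightarrow> ?y s \<in> U \<and> dist (?y s) (?y t) < d"
      unfolding eventually_nhds_metric by auto
    show ?thesis
    proof (intro exI conjI allI impI)
      fix s assume "norm (s - t) < \<epsilon>"
      then have s: "?y s \<in> U" "norm (?y s - ?y t) < d"
        using \<epsilon>(2)[of s] by (auto simp: dist_norm)
      have diff: "?y s - ?y t = (s - t) *\<^sub>R h"
        by (simp add: algebra_simps)
      have "\<bar>D j (?y s) ?vs - D j (?y t) ?vs - D (Suc j) (?y t) ((?y s - ?y t) # ?vs)\<bar>
          \<le> e' * norm (?y s - ?y t) * norm h ^ j"
        using d(2)[OF s, of ?vs] by (simp add: prod_list_replicate)
      also have "\<dots> = (e' * norm h ^ Suc j) * \<bar>s - t\<bar>"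
        unfolding diff by simp
      also have "\<dots> \<le> e * \<bar>s - t\<bar>"
        by (intro mult_right_mono e') auto
      finally show "norm (D j (?y s) ?vs - D j (?y t) ?vs
          - D (Suc j) (?y t) (replicate (Suc j) h) * (s - t)) \<le> e * norm (s - t)"
        unfolding diff lin by (simp add: mult.commute)
    qed (rule \<epsilon>(1))
  qed
  then show ?thesis
    unfolding has_field_derivative_def has_derivative_at_alt
    by (auto intro: bounded_linear_mult_right)
qed

definition axis_point :: "real \<Rightarrow> nat \<Rightarrow> real" where
  "axis_point t = (\<lambda>i. if i = 0 then t else 0)"

lemma partial_axis_point: "partial 0 g (axis_point t) = deriv (\<lambda>s. g (axis_point s)) t"
proof -
  have "(axis_point t)(0 := s) = axis_point s" for s
    by (auto simp: axis_point_def)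
  then show ?thesis
    by (simp add: partial_def) (simp add: axis_point_def)
qed

text \<open>
  The hypothesis holds only near \<open>0\<close>, so each step of the induction needs it in a whole
  neighbourhood of the point of differentiation. The constants \<open>c\<close> and \<open>a\<close> allow for a functional that
  is an affine function of \<open>F\<close>; the additive one is lost with the first derivative.
\<close>
lemma partials_along_line:
  fixes x h :: "'p::real_normed_vector"
  assumes D: "bounded_frechet_derivs k U F D" and U: "open U" "x \<in> U"
    and g: "\<forall>\<^sub>F t in nhds 0. g (axis_point t) = c + a * F (x + t *\<^sub>R h)" and j: "j \<le> k"
  shows "\<forall>\<^sub>F t in nhds 0. partials (replicate j 0) g (axis_point t)
    = (if j = 0 then c else 0) + a * D j (x + t *\<^sub>R h) (replicate j h)"
proof -
  have "((\<lambda>t. x + t *\<^sub>R h) \<longlongrightarrow> x + 0 *\<^sub>R h) (nhds 0)"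
    by (intro tendsto_intros filterlim_ident)
  then have inU: "\<forall>\<^sub>F t in nhds 0. x + t *\<^sub>R h \<in> U"
    using U by (intro topological_tendstoD) auto
  show ?thesis
    using j
  proof (induction j)
    case 0
    from g inU show ?case
      by eventually_elim (use D in \<open>simp add: bounded_frechet_derivs_def\<close>)
  next
    case (Suc j)
    then have "\<forall>\<^sub>F t in nhds 0. \<forall>\<^sub>F s in nhds t. partials (replicate j 0) g (axis_point s)
        = (if j = 0 then c else 0) + a * D j (x + s *\<^sub>R h) (replicate j h)"
      by (simp add: eventually_eventually)
    with inU show ?case
    proof eventually_elim
      case (elim t)
      have "((\<lambda>s. (if j = 0 then c else 0) + a * D j (x + s *\<^sub>R h) (replicate j h)) has_real_derivative
          a * D (Suc j) (x + t *\<^sub>R h) (replicate (Suc j) h)) (at t)"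
        using DERIV_add[OF DERIV_const DERIV_cmult[OF frechet_derivs_along_line[OF D U(1) elim(1)]]] Suc.prems
        by simp
      then have "deriv (\<lambda>s. (if j = 0 then c else 0) + a * D j (x + s *\<^sub>R h) (replicate j h)) t
          = a * D (Suc j) (x + t *\<^sub>R h) (replicate (Suc j) h)"
        by (rule DERIV_imp_deriv)
      moreover have "deriv (\<lambda>s. partials (replicate j 0) g (axis_point s)) t
          = deriv (\<lambda>s. (if j = 0 then c else 0) + a * D j (x + s *\<^sub>R h) (replicate j h)) t"
        by (intro deriv_cong_ev elim) simp
      ultimately show ?case
        by (simp add: partial_axis_point)
    qed
  qed
qed

text \<open>
  Taylor's formula with Lagrange remainder on the segment from \<open>x\<close> to \<open>x + \<delta>\<close>. The intermediate point
  depends on \<open>\<delta>\<close>, but the bounds on the derivatives of order \<open>m + 1\<close> hold on all of \<open>U\<close>.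
\<close>
lemma taylor_coefficients_agree_imp_bigo:
  fixes F1 F2 :: "'p::real_normed_vector \<Rightarrow> real"
  assumes D1: "bounded_frechet_derivs (m + 1) U F1 D1" and D2: "bounded_frechet_derivs (m + 1) U F2 D2"
    and U: "open U" "x \<in> U"
    and eq: "\<And>k h. k \<le> m \<Longrightarrow> D1 k x (replicate k h) = D2 k x (replicate k h)"
  shows "(\<lambda>\<delta>. F1 (x + \<delta>) - F2 (x + \<delta>)) \<in> O[at 0](\<lambda>\<delta>. norm \<delta> ^ (m + 1))"
proof -
  obtain \<rho> where \<rho>: "\<rho> > 0" "ball x \<rho> \<subseteq> U"
    using U open_contains_ball by blast
  obtain C1 where C1: "\<And>y vs. y \<in> U \<Longrightarrow> length vs = m + 1 \<Longrightarrow>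
      \<bar>D1 (m + 1) y vs\<bar> \<le> C1 * prod_list (map norm vs)"
    using bounded_frechet_derivsD(4)[OF D1 U(2), of "m + 1"] by auto
  obtain C2 where C2: "\<And>y vs. y \<in> U \<Longrightarrow> length vs = m + 1 \<Longrightarrow>
      \<bar>D2 (m + 1) y vs\<bar> \<le> C2 * prod_list (map norm vs)"
    using bounded_frechet_derivsD(4)[OF D2 U(2), of "m + 1"] by auto
  have bound: "\<bar>F1 (x + \<delta>) - F2 (x + \<delta>)\<bar> \<le> (C1 + C2) / fact (m + 1) * norm \<delta> ^ (m + 1)"
    if \<delta>: "norm \<delta> < \<rho>" for \<delta>
  proof -
    define d where "d = (\<lambda>j t. D1 j (x + t *\<^sub>R \<delta>) (replicate j \<delta>) - D2 j (x + t *\<^sub>R \<delta>) (replicate j \<delta>))"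
    have inU: "x + t *\<^sub>R \<delta> \<in> U" if "0 \<le> t" "t \<le> 1" for t
    proof -
      have "\<bar>t\<bar> * norm \<delta> \<le> 1 * norm \<delta>"
        using that by (intro mult_right_mono) auto
      then show ?thesis
        using \<delta> \<rho>(2) by (intro subsetD[OF \<rho>(2)]) (simp add: dist_norm)
    qed
    have "\<forall>j t. j < m + 1 \<and> 0 \<le> t \<and> t \<le> 1 \<longrightarrow> DERIV (d j) t :> d (Suc j) t"
      unfolding d_def
      by (auto intro!: DERIV_diff frechet_derivs_along_line[OF D1 U(1)] frechet_derivs_along_line[OF D2 U(1)]
          inU simp del: replicate_Suc)
    from Maclaurin2[of 1 d "d 0" "m + 1", OF _ _ this]
    obtain t where t: "0 < t" "t \<le> 1"
      "d 0 1 = (\<Sum>k<m + 1. d k 0 / fact k * 1 ^ k) + d (m + 1) t / fact (m + 1) * 1 ^ (m + 1)"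
      by auto
    have "(\<Sum>k<m + 1. d k 0 / fact k * 1 ^ k) = 0"
      by (intro sum.neutral) (auto simp: d_def eq)
    then have "d 0 1 = d (m + 1) t / fact (m + 1)"
      using t(3) by simp
    moreover have "d 0 1 = F1 (x + \<delta>) - F2 (x + \<delta>)"
      using D1 D2 inU[of 1] by (simp add: d_def bounded_frechet_derivs_def)
    moreover have "\<bar>d (m + 1) t\<bar> \<le> C1 * norm \<delta> ^ (m + 1) + C2 * norm \<delta> ^ (m + 1)"
      using C1[OF inU, of t "replicate (m + 1) \<delta>"] C2[OF inU, of t "replicate (m + 1) \<delta>"] t
      unfolding d_def by (simp add: prod_list_replicate)
    ultimately have "\<bar>F1 (x + \<delta>) - F2 (x + \<delta>)\<bar>
        \<le> (C1 * norm \<delta> ^ (m + 1) + C2 * norm \<delta> ^ (m + 1)) / fact (m + 1)"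
      by (auto simp: abs_divide simp del: fact_Suc intro!: divide_right_mono)
    then show ?thesis
      by (simp only: distrib_right times_divide_eq_left)
  qed
  show ?thesis
  proof (rule bigoI)
    show "\<forall>\<^sub>F \<delta> in at 0. norm (F1 (x + \<delta>) - F2 (x + \<delta>)) \<le> (C1 + C2) / fact (m + 1) * norm (norm \<delta> ^ (m + 1))"
      unfolding eventually_at using \<rho>(1) bound by (intro exI[of _ \<rho>]) auto
  qed
qed

section \<open>Derivatives and expansion of the expected influence function\<close>

theorem theorem2p2:
  fixes M :: "'a measure" and \<Theta> :: "'p::real_normed_vector set"
    and f :: "'p \<Rightarrow> 'a \<Rightarrow> real" and \<psi> :: "'p \<Rightarrow> real" and n m :: nat
    and \<R> :: "(nat \<times> ((nat \<Rightarrow> real) \<Rightarrow> 'p)) set"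
    and IFm :: "'p \<Rightarrow> (nat \<Rightarrow> 'a) \<Rightarrow> real"
  assumes model: "statistical_model M \<Theta> f"
    and regular: "\<forall>(r, \<theta>s)\<in>\<R>. regular_submodel M \<Theta> f n \<psi> m IFm r \<theta>s"
    and influence: "estimation_IF M \<Theta> f n \<psi> \<R> m IFm"
  shows
    "(\<forall>(r, \<theta>s)\<in>\<R>. \<forall>\<theta>\<in>\<theta>s ` coords r. \<forall>ls.
        1 \<le> length ls \<longrightarrow> length ls \<le> m \<longrightarrow> set ls \<subseteq> {..<r} \<longrightarrow>
          partials ls (\<lambda>\<zeta>. expect M f n \<theta> (IFm (\<theta>s \<zeta>))) (inv_into (coords r) \<theta>s \<theta>)
            = - psi_deriv r \<theta>s \<psi> ls \<theta>)
     \<and>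
     (\<forall>\<theta> U D1 D2.
        open U \<longrightarrow> \<theta> \<in> U \<longrightarrow> U \<subseteq> \<Theta> \<longrightarrow>
        (\<forall>h. h \<noteq> 0 \<longrightarrow> (\<exists>\<theta>s. (1, \<theta>s) \<in> \<R> \<and>
          (\<forall>\<^sub>F t in nhds 0. \<theta>s (\<lambda>i. if i = 0 then t else 0) = \<theta> + t *\<^sub>R h))) \<longrightarrow>
        bounded_frechet_derivs (m + 1) U (\<lambda>\<theta>'. expect M f n \<theta> (IFm \<theta>')) D1 \<longrightarrow>
        bounded_frechet_derivs (m + 1) U (\<lambda>\<theta>'. - (\<psi> \<theta>' - \<psi> \<theta>)) D2 \<longrightarrow>
        (\<forall>k\<le>m. \<forall>h. D1 k \<theta> (replicate k h) / fact k = D2 k \<theta> (replicate k h) / fact k) \<and>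
        (\<lambda>\<delta>. expect M f n \<theta> (IFm (\<theta> + \<delta>)) - (- (\<psi> (\<theta> + \<delta>) - \<psi> \<theta>)))
          \<in> O[at 0](\<lambda>\<delta>. norm \<delta> ^ (m + 1)))"
  (is "?derivs \<and> ?taylor")
proof
  have derivs: "partials ls (\<lambda>\<zeta>. expect M f n \<theta> (IFm (\<theta>s \<zeta>))) (inv_into (coords r) \<theta>s \<theta>)
      = - psi_deriv r \<theta>s \<psi> ls \<theta>"
    if "(r, \<theta>s) \<in> \<R>" "\<theta> \<in> \<theta>s ` coords r" "1 \<le> length ls" "length ls \<le> m" "set ls \<subseteq> {..<r}"
    for r \<theta>s \<theta> ls
    using that regular by (intro influence_partials[OF model _ influence]) auto
  then show ?derivs
    by blast
  show ?taylor
  proof (intro allI impI)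
    fix \<theta> U D1 D2
    assume U: "open U" "\<theta> \<in> U" "U \<subseteq> \<Theta>"
      and lines: "\<forall>h. h \<noteq> 0 \<longrightarrow> (\<exists>\<theta>s. (1, \<theta>s) \<in> \<R> \<and>
          (\<forall>\<^sub>F t in nhds 0. \<theta>s (\<lambda>i. if i = 0 then t else 0) = \<theta> + t *\<^sub>R h))"
      and D1: "bounded_frechet_derivs (m + 1) U (\<lambda>\<theta>'. expect M f n \<theta> (IFm \<theta>')) D1"
      and D2: "bounded_frechet_derivs (m + 1) U (\<lambda>\<theta>'. - (\<psi> \<theta>' - \<psi> \<theta>)) D2"
    have eq: "D1 k \<theta> (replicate k h) = D2 k \<theta> (replicate k h)" if k: "k \<le> m" for k h
    proof -
      consider "k = 0" | "k > 0" "h = 0" | "k > 0" "h \<noteq> 0"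
        by blast
      then show ?thesis
      proof cases
        case 1
        have "expect M f n \<theta> (IFm \<theta>) = 0"
          using influence U by (auto simp: estimation_IF_def)
        then show ?thesis
          using D1 D2 U 1 by (simp add: bounded_frechet_derivs_def)
      next
        case 2
        have "D k \<theta> (replicate k h) = 0" if D: "bounded_frechet_derivs (m + 1) U F D" for F D
        proof -
          from 2 obtain j where j: "k = Suc j"
            by (cases k) auto
          have "linear (\<lambda>v. D k \<theta> (v # replicate j h))"
            using bounded_frechet_derivsD(2)[OF D U(2), of k] k j by (intro multilinear_first) auto
          from linear_0[OF this] show ?thesis
            using 2 j by simp
        qed
        from this[OF D1] this[OF D2] show ?thesis
          by simp
      next
        case 3
        obtain \<theta>s where R: "(1, \<theta>s) \<in> \<R>" and line: "\<forall>\<^sub>F t in nhds 0. \<theta>s (axis_point t) = \<theta> + t *\<^sub>R h"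
          using lines 3 by (auto simp: axis_point_def)
        have at0: "\<theta>s (axis_point 0) = \<theta>"
          using eventually_nhds_x_imp_x[OF line] by simp
        have origin: "axis_point 0 \<in> coords 1"
          by (simp add: axis_point_def coords_def)
        have "inj_on \<theta>s (coords 1)"
          using regular R by (auto simp: regular_submodel_def smooth_submodel_def)
        then have inv: "inv_into (coords 1) \<theta>s \<theta> = axis_point 0"
          using at0 origin by (auto dest: inv_into_f_f)
        let ?E = "\<lambda>\<zeta>. expect M f n \<theta> (IFm (\<theta>s \<zeta>))"
        have "\<forall>\<^sub>F t in nhds 0. ?E (axis_point t) = 0 + 1 * expect M f n \<theta> (IFm (\<theta> + t *\<^sub>R h))"
          using line by eventually_elim simp
        from partials_along_line[OF D1 U(1,2) this, of k]
        have E: "partials (replicate k 0) ?E (axis_point 0) = D1 k \<theta> (replicate k h)"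
          using k 3 by (auto dest!: eventually_nhds_x_imp_x)
        \<comment> \<open>\<open>D2\<close> belongs to \<open>- (\<psi> - \<psi> \<theta>)\<close>, and \<open>\<psi>\<close> is recovered from it with \<open>c = \<psi> \<theta>\<close> and \<open>a = - 1\<close>.\<close>
        have "\<forall>\<^sub>F t in nhds 0. \<psi> (\<theta>s (axis_point t)) = \<psi> \<theta> + (- 1) * (- (\<psi> (\<theta> + t *\<^sub>R h) - \<psi> \<theta>))"
          using line by eventually_elim simp
        from partials_along_line[OF D2 U(1,2) this, of k]
        have P: "partials (replicate k 0) (\<lambda>\<zeta>. \<psi> (\<theta>s \<zeta>)) (axis_point 0) = - D2 k \<theta> (replicate k h)"
          using k 3 by (auto dest!: eventually_nhds_x_imp_x)
        have "partials (replicate k 0) ?E (inv_into (coords 1) \<theta>s \<theta>) = - psi_deriv 1 \<theta>s \<psi> (replicate k 0) \<theta>"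
          using k 3 at0 origin by (intro derivs[OF R]) auto
        then show ?thesis
          unfolding psi_deriv_def inv E P by simp
      qed
    qed
    then show "(\<forall>k\<le>m. \<forall>h. D1 k \<theta> (replicate k h) / fact k = D2 k \<theta> (replicate k h) / fact k) \<and>
        (\<lambda>\<delta>. expect M f n \<theta> (IFm (\<theta> + \<delta>)) - (- (\<psi> (\<theta> + \<delta>) - \<psi> \<theta>)))
          \<in> O[at 0](\<lambda>\<delta>. norm \<delta> ^ (m + 1))"
      using taylor_coefficients_agree_imp_bigo[OF D1 D2 U(1,2)] by auto
  qed
qed
end
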